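(* Let $\mathcal H = (H, \preceq)$ be a premonoid. Then all of the following implications hold for $\mathcal H$: f.g. $\Rightarrow$ l.f.g. $\Rightarrow$ weakly l.f.g.; f.g.u. $\Rightarrow$ l.f.g.u. $\Rightarrow$ weakly l.f.g.u.; f.g. $\Rightarrow$ f.g.u.; l.f.g. $\Rightarrow$ l.f.g.u.; weakly l.f.g. $\Rightarrow$ weakly l.f.g.u. In particular, every f.g.u. monoid is l.f.g.u. and every l.f.g.u. monoid is weakly l.f.g.u.
   Context: A premonoid is a pair $\mathcal H = (H, \preceq)$ consisting of a (multiplicatively written) monoid $H$ with identity $1_H$ and a preorder (reflexive, transitive relation) $\preceq$ on $H$; no compatibility is assumed. An element $u \in H$ is a $\preceq$-unit if $u \preceq 1_H \preceq u$ and a $\preceq$-non-unit otherwise; $\mathcal H^\times$ is the set of $\preceq$-units. A subpremonoid of $\mathcal H$ is a premonoid $(K, \preceq_K)$ where $K$ is a submonoid of $H$ and $\preceq_K$ is the restriction of $\preceq$ to $K$. For $X \subseteq H$, $\langle X \rangle_H$ is the submonoid of $H$ generated by $X$. For $x,y\in H$ write $x \mid_H y$ ("$x$ is a divisor of $y$ in $H$") if $y \in HxH$; $\mid_H$ is a preorder on $H$, the divisibility preorder. A submonoid $K$ of $H$ is divisor-closed if $x \mid_H y$ and $y \in K$ imply $x \in K$. For $x \in H$, $[\![x]\!]_H$ is the smallest divisor-closed submonoid of $H$ containing $x$, and $[\![x]\!]_{\mathcal H}$ is the subpremonoid of $\mathcal H$ with underlying monoid $[\![x]\!]_H$. Also,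 $\langle\!\langle x \rangle\!\rangle_H$ is the submonoid of $H$ generated by all the divisors of $x$ in $H$, and the germ $\langle\!\langle x \rangle\!\rangle_{\mathcal H}$ of $\mathcal H$ at $x$ is the subpremonoid of $\mathcal H$ with underlying monoid $\langle\!\langle x \rangle\!\rangle_H$. The premonoid $\mathcal H$ is: f.g. if $H = \langle A \rangle_H$ for some finite $A \subseteq H$; f.g.u. if $H = \langle \mathcal H^\times A\, \mathcal H^\times \rangle_H$ for some finite $A \subseteq H$; l.f.g. (resp., l.f.g.u.) if $[\![x]\!]_{\mathcal H}$ is an f.g. (resp., f.g.u.) premonoid for every $\preceq$-non-unit $x$; weakly l.f.g. (resp., weakly l.f.g.u.) if the germ $\langle\!\langle x \rangle\!\rangle_{\mathcal H}$ is an f.g. (resp., f.g.u.) premonoid for every $\preceq$-non-unit $x$. A monoid $H$ is said to be f.g.u., l.f.g.u., or weakly l.f.g.u. if the premonoid $(H, \mid_H)$ is. *)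

theory Defs
  imports "HOL-Algebra.Coset" "HOL.Hull"
begin

record 'a premonoid = "'a monoid" + preord :: "('a \<times> 'a) set"

locale premonoid = monoid H for H :: "('a, 'b) premonoid_scheme" (structure) +
  assumes preorder: "preorder_on (carrier H) (preord H)"

definition punits :: "('a, 'b) premonoid_scheme \<Rightarrow> 'a set" where
  "punits H = {u \<in> carrier H. (u, \<one>\<^bsub>H\<^esub>) \<in> preord H \<and> (\<one>\<^bsub>H\<^esub>, u) \<in> preord H}"

definition subpremonoid :: "('a, 'b) premonoid_scheme \<Rightarrow> 'a set \<Rightarrow> ('a, 'b) premonoid_scheme" where
  "subpremonoid H K = H\<lparr>carrier := K, preord := Restr (preord H) K\<rparr>"

definition mgen :: "('a, 'b) monoid_scheme \<Rightarrow> 'a set \<Rightarrow> 'a set" where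
  "mgen H X = (\<lambda>K. submonoid K H) hull X"

(* Two-sided divisibility; the library's factor is one-sided. *)
definition mdvd :: "('a, 'b) monoid_scheme \<Rightarrow> 'a \<Rightarrow> 'a \<Rightarrow> bool" where
  "mdvd H x y \<longleftrightarrow> x \<in> carrier H \<and> y \<in> carrier H \<and>
     (\<exists>u\<in>carrier H. \<exists>v\<in>carrier H. y = u \<otimes>\<^bsub>H\<^esub> x \<otimes>\<^bsub>H\<^esub> v)"

definition divisor_closed :: "('a, 'b) monoid_scheme \<Rightarrow> 'a set \<Rightarrow> bool" where
  "divisor_closed H K \<longleftrightarrow> (\<forall>x y. mdvd H x y \<longrightarrow> y \<in> K \<longrightarrow> x \<in> K)"

definition dclosure :: "('a, 'b) monoid_scheme \<Rightarrow> 'a \<Rightarrow> 'a set" where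
  "dclosure H x = (\<lambda>K. submonoid K H \<and> divisor_closed H K) hull {x}"

definition germ :: "('a, 'b) monoid_scheme \<Rightarrow> 'a \<Rightarrow> 'a set" where
  "germ H x = mgen H {y. mdvd H y x}"

definition fg :: "('a, 'b) premonoid_scheme \<Rightarrow> bool" where
  "fg H \<longleftrightarrow> (\<exists>A. finite A \<and> A \<subseteq> carrier H \<and> carrier H = mgen H A)"

definition fgu :: "('a, 'b) premonoid_scheme \<Rightarrow> bool" where
  "fgu H \<longleftrightarrow> (\<exists>A. finite A \<and> A \<subseteq> carrier H \<and>
     carrier H = mgen H (punits H <#>\<^bsub>H\<^esub> A <#>\<^bsub>H\<^esub> punits H))"

definition lfg :: "('a, 'b) premonoid_scheme \<Rightarrow> bool" where
  "lfg H \<longleftrightarrow> (\<forall>x \<in> carrier H - punits H. fg (subpremonoid H (dclosure H x)))"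

definition lfgu :: "('a, 'b) premonoid_scheme \<Rightarrow> bool" where
  "lfgu H \<longleftrightarrow> (\<forall>x \<in> carrier H - punits H. fgu (subpremonoid H (dclosure H x)))"

definition weakly_lfg :: "('a, 'b) premonoid_scheme \<Rightarrow> bool" where
  "weakly_lfg H \<longleftrightarrow> (\<forall>x \<in> carrier H - punits H. fg (subpremonoid H (germ H x)))"

definition weakly_lfgu :: "('a, 'b) premonoid_scheme \<Rightarrow> bool" where
  "weakly_lfgu H \<longleftrightarrow> (\<forall>x \<in> carrier H - punits H. fgu (subpremonoid H (germ H x)))"

definition dvd_premonoid :: "('a, 'b) monoid_scheme \<Rightarrow> 'a premonoid" where
  "dvd_premonoid M = \<lparr>carrier = carrier M, mult = mult M, one = one M,
     preord = {(x, y). mdvd M x y}\<rparr>"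

definition fgu_monoid :: "('a, 'b) monoid_scheme \<Rightarrow> bool" where
  "fgu_monoid M \<longleftrightarrow> fgu (dvd_premonoid M)"

definition lfgu_monoid :: "('a, 'b) monoid_scheme \<Rightarrow> bool" where
  "lfgu_monoid M \<longleftrightarrow> lfgu (dvd_premonoid M)"

definition weakly_lfgu_monoid :: "('a, 'b) monoid_scheme \<Rightarrow> bool" where
  "weakly_lfgu_monoid M \<longleftrightarrow> weakly_lfgu (dvd_premonoid M)"

lemma submonoid_mgen:
  assumes "monoid H" "X \<subseteq> carrier H"
  shows "submonoid (mgen H X) H"
proof -
  interpret monoid H by fact
  have "submonoid (carrier H) H" by unfold_locales auto
  then show ?thesis
    using assms(2) unfolding mgen_def hull_def submonoid_def by auto
qed

lemma dclosure_submonoid_divisor_closed: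
  assumes "monoid H" "x \<in> carrier H"
  shows "submonoid (dclosure H x) H" "divisor_closed H (dclosure H x)" "x \<in> dclosure H x"
proof -
  interpret monoid H by fact
  have "submonoid (carrier H) H" by unfold_locales auto
  moreover have "divisor_closed H (carrier H)"
    by (auto simp: divisor_closed_def mdvd_def)
  ultimately show "submonoid (dclosure H x) H"
    using assms(2) unfolding dclosure_def hull_def submonoid_def by auto
  show "divisor_closed H (dclosure H x)"
    unfolding dclosure_def hull_def divisor_closed_def by blast
  show "x \<in> dclosure H x"
    unfolding dclosure_def by (simp add: hull_inc)
qed

lemma premonoid_subpremonoid:
  assumes "premonoid H" "submonoid K H"
  shows "premonoid (subpremonoid H K)"
proof -
  interpret premonoid H by fact
  interpret K: submonoid K H by fact
  show ?thesis
  proof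
    show "preorder_on (carrier (subpremonoid H K)) (preord (subpremonoid H K))"
      using preorder K.subset
      by (auto simp: subpremonoid_def preorder_on_def refl_on_def intro!: transI dest: transD)
  qed (use K.subset in \<open>auto simp: subpremonoid_def m_assoc subset_iff\<close>)
qed

lemma premonoid_dvd_premonoid:
  assumes "monoid M"
  shows "premonoid (dvd_premonoid M)"
proof -
  interpret monoid M by fact
  have mdvd_carrier: "x \<in> carrier M" "y \<in> carrier M" if "mdvd M x y" for x y
    using that by (auto simp: mdvd_def)
  have refl: "mdvd M x x" if "x \<in> carrier M" for x
    using that unfolding mdvd_def by (auto intro!: bexI[of _ "\<one>\<^bsub>M\<^esub>"])
  have trans: "mdvd M x z" if xy: "mdvd M x y" and yz: "mdvd M y z" for x y z
  proof -
    from xy obtain u v where uv: "u \<in> carrier M" "v \<in> carrier M" "y = u \<otimes>\<^bsub>M\<^esub> x \<otimes>\<^bsub>M\<^esub> v"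
      and x: "x \<in> carrier M" unfolding mdvd_def by blast
    from yz obtain s t where st: "s \<in> carrier M" "t \<in> carrier M" "z = s \<otimes>\<^bsub>M\<^esub> y \<otimes>\<^bsub>M\<^esub> t"
      and z: "z \<in> carrier M" unfolding mdvd_def by blast
    have "z = (s \<otimes>\<^bsub>M\<^esub> u) \<otimes>\<^bsub>M\<^esub> x \<otimes>\<^bsub>M\<^esub> (v \<otimes>\<^bsub>M\<^esub> t)"
      using uv st x by (simp add: m_assoc)
    then show ?thesis using uv st x z unfolding mdvd_def by blast
  qed
  show ?thesis
  proof
    show "preorder_on (carrier (dvd_premonoid M)) (preord (dvd_premonoid M))"
      using refl trans mdvd_carrier
      by (auto simp: dvd_premonoid_def preorder_on_def refl_on_def intro!: transI)
  qed (auto simp: dvd_premonoid_def m_assoc)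
qed

end

theory Submission
  imports Defs
begin

text \<open>
  If a monoid is generated by \<open>X\<close> and \<open>D\<close> is closed under taking divisors, then in any
  factorization of an element of \<open>D\<close> over \<open>X\<close> each factor is a divisor of that element, hence lies
  in \<open>D\<close>; so \<open>X \<inter> D\<close> generates the same submonoid as \<open>D\<close>. With \<open>D\<close> a divisor-closed
  submonoid this passes from the whole premonoid to its local parts, and with \<open>D\<close> the divisors
  of \<open>x\<close> it passes from these to the germs. For the f.g.u. variants, \<open>X\<close> is the set of products
  \<open>uav\<close> with \<open>u\<close>, \<open>v\<close> units, and \<open>uav \<in> D\<close> forces \<open>u\<close>, \<open>a\<close>, \<open>v\<close> into \<open>D\<close> as well.
\<close>

section \<open>Generated submonoids and divisibility\<close>

lemma subset_mgen: "X \<subseteq> mgen H X"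
  unfolding mgen_def by (rule hull_subset)

lemma mgen_mono: "X \<subseteq> Y \<Longrightarrow> mgen H X \<subseteq> mgen H Y"
  unfolding mgen_def by (rule hull_mono)

lemma mgen_minimal: "X \<subseteq> K \<Longrightarrow> submonoid K H \<Longrightarrow> mgen H X \<subseteq> K"
  unfolding mgen_def by (rule hull_minimal)

lemma submonoid_carrier: "monoid H \<Longrightarrow> submonoid (carrier H) H"
  by (simp add: submonoid_def monoid.m_closed monoid.one_closed)

lemma mgen_submonoid: "submonoid K H \<Longrightarrow> mgen H K = K"
  unfolding mgen_def by (rule hull_same)

lemma mdvd_mult:
  assumes "monoid H" "x \<in> carrier H" "y \<in> carrier H"
  shows "mdvd H x (x \<otimes>\<^bsub>H\<^esub> y)" "mdvd H y (x \<otimes>\<^bsub>H\<^esub> y)"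
proof -
  interpret monoid H by fact
  have "x \<otimes>\<^bsub>H\<^esub> y = \<one>\<^bsub>H\<^esub> \<otimes>\<^bsub>H\<^esub> x \<otimes>\<^bsub>H\<^esub> y" "x \<otimes>\<^bsub>H\<^esub> y = x \<otimes>\<^bsub>H\<^esub> y \<otimes>\<^bsub>H\<^esub> \<one>\<^bsub>H\<^esub>"
    using assms by simp_all
  then show "mdvd H x (x \<otimes>\<^bsub>H\<^esub> y)" "mdvd H y (x \<otimes>\<^bsub>H\<^esub> y)"
    using assms unfolding mdvd_def by blast+
qed

lemma mdvd_trans:
  assumes "monoid H" "mdvd H x y" "mdvd H y z"
  shows "mdvd H x z"
  using premonoid.preorder[OF premonoid_dvd_premonoid[OF assms(1)]] assms(2,3)
  by (auto simp: dvd_premonoid_def preorder_on_def dest: transD)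

lemma divisor_closed_mult:
  assumes "monoid H" "divisor_closed H D" "x \<in> carrier H" "y \<in> carrier H" "x \<otimes>\<^bsub>H\<^esub> y \<in> D"
  shows "x \<in> D" "y \<in> D"
  using assms mdvd_mult[OF assms(1,3,4)] unfolding divisor_closed_def by blast+

text \<open>\<open>D\<close> is an arbitrary divisor-closed set here, since the divisors of a fixed
  element rarely form a submonoid.\<close>

lemma mgen_divisor_closed:
  assumes H: "monoid H" and X: "X \<subseteq> carrier H" "carrier H = mgen H X"
    and D: "D \<subseteq> carrier H" "divisor_closed H D"
  shows "mgen H D = mgen H (X \<inter> D)"
proof
  have sub: "submonoid (mgen H (X \<inter> D)) H"
    using H X(1) by (intro submonoid_mgen) auto
  \<comment> \<open>Making membership in \<open>D\<close> a premise turns \<open>?K\<close> into a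
    submonoid: if a product lies in \<open>D\<close>, so do both factors, and the premise then holds
    for each of them.\<close>
  let ?K = "{y \<in> carrier H. y \<in> D \<longrightarrow> y \<in> mgen H (X \<inter> D)}"
  have "submonoid ?K H"
  proof
    fix x y assume xy: "x \<in> ?K" "y \<in> ?K"
    have "x \<otimes>\<^bsub>H\<^esub> y \<in> mgen H (X \<inter> D)" if "x \<otimes>\<^bsub>H\<^esub> y \<in> D"
      using xy divisor_closed_mult[OF H D(2) _ _ that] submonoid.m_closed[OF sub] by simp
    then show "x \<otimes>\<^bsub>H\<^esub> y \<in> ?K"
      using xy monoid.m_closed[OF H] by simp
  qed (use monoid.one_closed[OF H] submonoid.one_closed[OF sub] in auto)
  moreover have "X \<subseteq> ?K"
    using X(1) subset_mgen[of "X \<inter> D" H] by auto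
  ultimately have "carrier H \<subseteq> ?K"
    using X(2) mgen_minimal by metis
  then have "D \<subseteq> mgen H (X \<inter> D)"
    using D(1) by auto
  then show "mgen H D \<subseteq> mgen H (X \<inter> D)"
    using sub by (rule mgen_minimal)
  show "mgen H (X \<inter> D) \<subseteq> mgen H D"
    by (rule mgen_mono) simp
qed

section \<open>Subpremonoids and inheritance of finite generation\<close>

lemma subpremonoid_simps [simp]:
  "carrier (subpremonoid H K) = K"
  "mult (subpremonoid H K) = mult H"
  "one (subpremonoid H K) = one H"
  by (simp_all add: subpremonoid_def)

lemma subpremonoid_subpremonoid:
  "L \<subseteq> K \<Longrightarrow> subpremonoid (subpremonoid H K) L = subpremonoid H L"
  unfolding subpremonoid_def by (simp add: Int_assoc inf.absorb2 Sigma_mono Times_Int_Times)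

text \<open>The submonoids of the subpremonoid are the submonoids of \<open>H\<close> inside
  \<open>K\<close>, and cutting any submonoid of \<open>H\<close> down to \<open>K\<close> yields
  one of these, so both hulls agree.\<close>

lemma mgen_subpremonoid:
  assumes K: "submonoid K H" and X: "X \<subseteq> K"
  shows "mgen (subpremonoid H K) X = mgen H X"
proof -
  have iff: "submonoid L (subpremonoid H K) \<longleftrightarrow> L \<subseteq> K \<and> submonoid L H" for L
    using K by (auto simp: submonoid_def)
  have "submonoid (L \<inter> K) H" if "submonoid L H" for L
    using K that by (auto simp: submonoid_def)
  then show ?thesis
    using X unfolding mgen_def hull_def iff by blast
qed

lemma punits_subpremonoid:
  "submonoid K H \<Longrightarrow> punits (subpremonoid H K) = punits H \<inter> K"
  by (auto simp: punits_def subpremonoid_def submonoid_def)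

lemma punits_subset: "punits H \<subseteq> carrier H"
  by (auto simp: punits_def)

lemma one_in_punits: "premonoid H \<Longrightarrow> \<one>\<^bsub>H\<^esub> \<in> punits H"
  by (auto simp: punits_def premonoid_def premonoid_axioms_def preorder_on_def refl_on_def
      monoid.one_closed)

lemma premonoid_imp_monoid: "premonoid H \<Longrightarrow> monoid H"
  by (simp add: premonoid_def)

lemma set_mult_subset: "submonoid K H \<Longrightarrow> A \<subseteq> K \<Longrightarrow> B \<subseteq> K \<Longrightarrow> A <#>\<^bsub>H\<^esub> B \<subseteq> K"
  unfolding set_mult_def submonoid_def by blast

lemma set_mult_subpremonoid: "A <#>\<^bsub>subpremonoid H K\<^esub> B = A <#>\<^bsub>H\<^esub> B"
  by (simp add: set_mult_def)

text \<open>Serves both local steps: \<open>D\<close> is either a divisor-closed submonoid, equal to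
  \<open>mgen H D\<close>, or the set of divisors of an element, generating its germ.\<close>

lemma fg_divisor_closed:
  assumes H: "monoid H" and fg: "fg H" and D: "D \<subseteq> carrier H" "divisor_closed H D"
  shows "fg (subpremonoid H (mgen H D))"
proof -
  obtain A where A: "finite A" "A \<subseteq> carrier H" "carrier H = mgen H A"
    using fg unfolding fg_def by blast
  have AD: "A \<inter> D \<subseteq> mgen H D"
    using subset_mgen[of D H] by blast
  have "mgen (subpremonoid H (mgen H D)) (A \<inter> D) = mgen H (A \<inter> D)"
    by (rule mgen_subpremonoid[OF submonoid_mgen[OF H D(1)] AD])
  with AD show ?thesis
    using A(1) mgen_divisor_closed[OF H A(2,3) D] unfolding fg_def
    by (intro exI[of _ "A \<inter> D"]) simp
qed

lemma fgu_divisor_closed: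
  assumes H: "monoid H" and fgu: "fgu H" and D: "D \<subseteq> carrier H" "divisor_closed H D"
  shows "fgu (subpremonoid H (mgen H D))"
proof -
  let ?T = "mgen H D"
  obtain A where A: "finite A" "A \<subseteq> carrier H"
    "carrier H = mgen H (punits H <#>\<^bsub>H\<^esub> A <#>\<^bsub>H\<^esub> punits H)"
    using fgu unfolding fgu_def by blast
  let ?X = "punits H <#>\<^bsub>H\<^esub> A <#>\<^bsub>H\<^esub> punits H"
  \<comment> \<open>The units of the subpremonoid on \<open>?T\<close> are
    \<open>punits H \<inter> ?T\<close> and may lie outside \<open>D\<close>. Hence
    \<open>?Y\<close> is bounded by \<open>?T\<close> instead of \<open>D\<close>; the sandwich
    between \<open>?X \<inter> D\<close> and \<open>?T\<close> fixes what it generates.\<close>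
  let ?Y = "(punits H \<inter> ?T) <#>\<^bsub>H\<^esub> (A \<inter> ?T) <#>\<^bsub>H\<^esub> (punits H \<inter> ?T)"
  have T: "submonoid ?T H"
    by (rule submonoid_mgen[OF H D(1)])
  have X: "?X \<subseteq> carrier H"
    using A(2) punits_subset by (intro set_mult_subset submonoid_carrier[OF H])
  have XD: "?X \<inter> D \<subseteq> ?Y"
  proof
    fix y assume "y \<in> ?X \<inter> D"
    then obtain u a v where uav: "u \<in> punits H" "a \<in> A" "v \<in> punits H"
      and y: "y = u \<otimes>\<^bsub>H\<^esub> a \<otimes>\<^bsub>H\<^esub> v" "y \<in> D"
      by (auto simp: set_mult_def)
    then have car: "u \<in> carrier H" "a \<in> carrier H" "v \<in> carrier H"
      using punits_subset[of H] A(2) by blast+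
    then have "u \<otimes>\<^bsub>H\<^esub> a \<in> D" "v \<in> D"
      using divisor_closed_mult[OF H D(2), of "u \<otimes>\<^bsub>H\<^esub> a" v] y
      by (auto simp: monoid.m_closed[OF H])
    moreover from this have "u \<in> D" "a \<in> D"
      using divisor_closed_mult[OF H D(2) car(1,2)] by blast+
    ultimately have "u \<in> ?T" "a \<in> ?T" "v \<in> ?T"
      using subset_mgen[of D H] by blast+
    then show "y \<in> ?Y"
      using uav y(1) unfolding set_mult_def by blast
  qed
  have YT: "?Y \<subseteq> ?T"
    by (intro set_mult_subset T) auto
  have "mgen H ?Y = ?T"
  proof
    show "?T \<subseteq> mgen H ?Y"
      using mgen_divisor_closed[OF H X A(3) D] mgen_mono[OF XD] by simp
    show "mgen H ?Y \<subseteq> ?T"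
      by (rule mgen_minimal[OF YT T])
  qed
  then show ?thesis
    using A(1) unfolding fgu_def
    by (intro exI[of _ "A \<inter> ?T"])
      (simp add: punits_subpremonoid[OF T] set_mult_subpremonoid mgen_subpremonoid[OF T YT])
qed

text \<open>The identity is a unit by reflexivity, so each generator \<open>a\<close> is the product
  of \<open>a\<close> with trivial units on both sides.\<close>

lemma fg_imp_fgu:
  assumes H: "premonoid H" and "fg H"
  shows "fgu H"
proof -
  interpret premonoid H by (rule H)
  obtain A where A: "finite A" "A \<subseteq> carrier H" "carrier H = mgen H A"
    using assms(2) unfolding fg_def by blast
  let ?X = "punits H <#>\<^bsub>H\<^esub> A <#>\<^bsub>H\<^esub> punits H"
  have "A \<subseteq> ?X"
  proof
    fix a assume "a \<in> A"
    moreover from this have "a = \<one>\<^bsub>H\<^esub> \<otimes>\<^bsub>H\<^esub> a \<otimes>\<^bsub>H\<^esub> \<one>\<^bsub>H\<^esub>"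
      using A(2) by auto
    ultimately show "a \<in> ?X"
      using one_in_punits[OF H] unfolding set_mult_def by blast
  qed
  then have "carrier H \<subseteq> mgen H ?X"
    using A(3) mgen_mono by metis
  moreover have "mgen H ?X \<subseteq> carrier H"
    using A(2) punits_subset
    by (intro mgen_minimal set_mult_subset submonoid_carrier monoid_axioms)
  ultimately show ?thesis
    using A(1,2) unfolding fgu_def by blast
qed

section \<open>Germs inside divisor closures\<close>

lemma submonoid_germ:
  assumes "monoid H"
  shows "submonoid (germ H x) H"
  unfolding germ_def using assms by (rule submonoid_mgen) (auto simp: mdvd_def)

text \<open>Allows the germ at \<open>x\<close> to be computed inside the divisor closure
  \<open>K\<close> of \<open>x\<close>, where it is again generated by a divisor-closed set.\<close>

lemma subpremonoid_germ:
  assumes H: "monoid H" and x: "x \<in> carrier H"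
  defines "K \<equiv> subpremonoid H (dclosure H x)" and "D \<equiv> {y. mdvd H y x}"
  shows "D \<subseteq> carrier K" "divisor_closed K D" "subpremonoid K (mgen K D) = subpremonoid H (germ H x)"
proof -
  note K = dclosure_submonoid_divisor_closed[OF H x]
  have sub: "dclosure H x \<subseteq> carrier H"
    using K(1) by (simp add: submonoid_def)
  show D: "D \<subseteq> carrier K"
    using K(2,3) by (auto simp: K_def D_def divisor_closed_def)
  \<comment> \<open>Cofactors taken from \<open>K\<close> are cofactors in \<open>H\<close>, so
    transitivity in \<open>H\<close> shows that a \<open>K\<close>-divisor of a divisor of
    \<open>x\<close> divides \<open>x\<close>.\<close>
  have "mdvd H y z" if "mdvd K y z" for y z
    using that sub unfolding mdvd_def K_def by auto
  then show "divisor_closed K D"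
    using mdvd_trans[OF H] unfolding divisor_closed_def D_def by blast
  have "mgen K D = germ H x"
    using D mgen_subpremonoid[OF K(1), of D] by (simp add: K_def D_def germ_def)
  moreover have "germ H x \<subseteq> dclosure H x"
    using D mgen_minimal[OF _ K(1)] by (simp add: K_def D_def germ_def)
  ultimately show "subpremonoid K (mgen K D) = subpremonoid H (germ H x)"
    by (simp add: K_def subpremonoid_subpremonoid)
qed

section \<open>The implications between the finiteness conditions\<close>

context
  fixes H :: "('a, 'b) premonoid_scheme"
  assumes H: "premonoid H"
begin

lemma monoid_subpremonoid_dclosure:
  "x \<in> carrier H \<Longrightarrow> monoid (subpremonoid H (dclosure H x))"
  using H dclosure_submonoid_divisor_closed(1)[OF premonoid_imp_monoid[OF H]]
  by (intro premonoid_imp_monoid premonoid_subpremonoid)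

lemma fg_imp_lfg:
  assumes "fg H"
  shows "lfg H"
  unfolding lfg_def
proof
  fix x assume "x \<in> carrier H - punits H"
  then have x: "x \<in> carrier H" by simp
  note K = dclosure_submonoid_divisor_closed[OF premonoid_imp_monoid[OF H] x]
  show "fg (subpremonoid H (dclosure H x))"
    using fg_divisor_closed[OF premonoid_imp_monoid[OF H] assms submonoid.subset[OF K(1)] K(2)]
    by (simp add: mgen_submonoid[OF K(1)])
qed

lemma fgu_imp_lfgu:
  assumes "fgu H"
  shows "lfgu H"
  unfolding lfgu_def
proof
  fix x assume "x \<in> carrier H - punits H"
  then have x: "x \<in> carrier H" by simp
  note K = dclosure_submonoid_divisor_closed[OF premonoid_imp_monoid[OF H] x]
  show "fgu (subpremonoid H (dclosure H x))"
    using fgu_divisor_closed[OF premonoid_imp_monoid[OF H] assms submonoid.subset[OF K(1)] K(2)]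
    by (simp add: mgen_submonoid[OF K(1)])
qed

text \<open>The inheritance lemma is applied with the divisor closure of \<open>x\<close>, finitely
  generated by assumption, as the ambient premonoid in place of \<open>H\<close>.\<close>

lemma lfg_imp_weakly_lfg:
  assumes "lfg H"
  shows "weakly_lfg H"
  unfolding weakly_lfg_def
proof
  fix x assume x: "x \<in> carrier H - punits H"
  then have "x \<in> carrier H" by simp
  note germ = subpremonoid_germ[OF premonoid_imp_monoid[OF H] this]
    and K = monoid_subpremonoid_dclosure[OF this]
  have "fg (subpremonoid H (dclosure H x))"
    using assms x unfolding lfg_def by blast
  then show "fg (subpremonoid H (germ H x))"
    using fg_divisor_closed[OF K _ germ(1,2)] germ(3) by simp
qed

lemma lfgu_imp_weakly_lfgu:
  assumes "lfgu H"
  shows "weakly_lfgu H"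
  unfolding weakly_lfgu_def
proof
  fix x assume x: "x \<in> carrier H - punits H"
  then have "x \<in> carrier H" by simp
  note germ = subpremonoid_germ[OF premonoid_imp_monoid[OF H] this]
    and K = monoid_subpremonoid_dclosure[OF this]
  have "fgu (subpremonoid H (dclosure H x))"
    using assms x unfolding lfgu_def by blast
  then show "fgu (subpremonoid H (germ H x))"
    using fgu_divisor_closed[OF K _ germ(1,2)] germ(3) by simp
qed

lemma lfg_imp_lfgu: "lfg H \<Longrightarrow> lfgu H"
  using H dclosure_submonoid_divisor_closed(1)[OF premonoid_imp_monoid[OF H]]
  unfolding lfg_def lfgu_def by (auto intro!: fg_imp_fgu premonoid_subpremonoid)

lemma weakly_lfg_imp_weakly_lfgu: "weakly_lfg H \<Longrightarrow> weakly_lfgu H"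
  using H submonoid_germ[OF premonoid_imp_monoid[OF H]]
  unfolding weakly_lfg_def weakly_lfgu_def by (auto intro!: fg_imp_fgu premonoid_subpremonoid)

end

theorem proposition4p3:
  fixes H :: "('a, 'b) premonoid_scheme"
  assumes "premonoid H"
  shows "(fg H \<longrightarrow> lfg H) \<and> (lfg H \<longrightarrow> weakly_lfg H)
    \<and> (fgu H \<longrightarrow> lfgu H) \<and> (lfgu H \<longrightarrow> weakly_lfgu H)
    \<and> (fg H \<longrightarrow> fgu H) \<and> (lfg H \<longrightarrow> lfgu H) \<and> (weakly_lfg H \<longrightarrow> weakly_lfgu H)
    \<and> (\<forall>M :: ('c, 'd) monoid_scheme. monoid M \<longrightarrow>
         (fgu_monoid M \<longrightarrow> lfgu_monoid M) \<and> (lfgu_monoid M \<longrightarrow> weakly_lfgu_monoid M))"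
proof (intro conjI allI impI)
  fix M :: "('c, 'd) monoid_scheme"
  assume "monoid M"
  \<comment> \<open>The monoid notions are the premonoid notions for the divisibility preorder, so
    the general implications specialize.\<close>
  note dvd = premonoid_dvd_premonoid[OF this]
  show "lfgu_monoid M" if "fgu_monoid M"
    using that fgu_imp_lfgu[OF dvd] by (simp add: fgu_monoid_def lfgu_monoid_def)
  show "weakly_lfgu_monoid M" if "lfgu_monoid M"
    using that lfgu_imp_weakly_lfgu[OF dvd] by (simp add: lfgu_monoid_def weakly_lfgu_monoid_def)
qed (use assms in \<open>simp_all add: fg_imp_lfg lfg_imp_weakly_lfg fgu_imp_lfgu lfgu_imp_weakly_lfgu
    fg_imp_fgu lfg_imp_lfgu weakly_lfg_imp_weakly_lfgu\<close>)

end
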